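(* Let $k \ge \ell \ge 2$ be integers. Let $\varepsilon \in \left(0,\frac{1}{4k}\right)$. Let $G$ be a graph with $d=\mathrm{d}(G) \ge 1/\varepsilon$. Then $G$ contains at least one of the following: (i) a subgraph $H$ with $|V(H)|\le 3k^3d$ and $|E(H)|\ge \varepsilon^2d^2/2$, or (ii) a bipartite subgraph $H=(X,Y)$ with $|X| > \ell |Y|$ such that every vertex in $X$ has at least $(1-2k\varepsilon)d$ neighbors in $Y$, or (iii) a $k$-bounded minor $G'$ with $\mathrm{d}(G') \ge \frac{k}{8\ell} (1-2k\varepsilon) d$.
   Context: All graphs are finite and simple. $\mathrm{d}(G)=|E(G)|/|V(G)|$ denotes density. A $k$-bounded minor of $G$ is a minor having a model in $G$ in which every branch set has at most $k$ vertices (i.e. obtained from a subgraph by contracting connected subgraphs on at most $k$ vertices). *)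

theory Defs
  imports Complex_Main
begin

datatype 'a graph = Graph (verts: "'a set") (edges: "'a set set")

definition simple_graph :: "'a graph \<Rightarrow> bool" where
  "simple_graph G \<longleftrightarrow> finite (verts G) \<and> (\<forall>e\<in>edges G. e \<subseteq> verts G \<and> card e = 2)"

definition density :: "'a graph \<Rightarrow> real" where
  "density G = real (card (edges G)) / real (card (verts G))"

definition subgraph :: "'a graph \<Rightarrow> 'a graph \<Rightarrow> bool" where
  "subgraph H G \<longleftrightarrow> simple_graph H \<and> verts H \<subseteq> verts G \<and> edges H \<subseteq> edges G"

definition induced_subgraph :: "'a graph \<Rightarrow> 'a set \<Rightarrow> 'a graph" where
  "induced_subgraph G S = Graph (verts G \<inter> S) {e \<in> edges G. e \<subseteq> S}"

definition neighbors :: "'a graph \<Rightarrow> 'a \<Rightarrow> 'a set" where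
  "neighbors G v = {u. {v, u} \<in> edges G}"

definition bipartition :: "'a graph \<Rightarrow> 'a set \<Rightarrow> 'a set \<Rightarrow> bool" where
  "bipartition H X Y \<longleftrightarrow> X \<inter> Y = {} \<and> X \<union> Y = verts H \<and>
     (\<forall>e\<in>edges H. \<exists>x\<in>X. \<exists>y\<in>Y. e = {x, y})"

definition connected_graph :: "'a graph \<Rightarrow> bool" where
  "connected_graph G \<longleftrightarrow> verts G \<noteq> {} \<and>
     (\<forall>u\<in>verts G. \<forall>v\<in>verts G. (u, v) \<in> {(x, y). {x, y} \<in> edges G}\<^sup>*)"

text \<open>Branch sets are nonempty because \<^const>\<open>connected_graph\<close> excludes the null graph.\<close>

definition minor_model :: "('b \<Rightarrow> 'a set) \<Rightarrow> 'b graph \<Rightarrow> 'a graph \<Rightarrow> bool" where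
  "minor_model B M G \<longleftrightarrow>
     (\<forall>v\<in>verts M. B v \<subseteq> verts G \<and> connected_graph (induced_subgraph G (B v))) \<and>
     (\<forall>u\<in>verts M. \<forall>v\<in>verts M. u \<noteq> v \<longrightarrow> B u \<inter> B v = {}) \<and>
     (\<forall>u v. {u, v} \<in> edges M \<longrightarrow> (\<exists>x\<in>B u. \<exists>y\<in>B v. {x, y} \<in> edges G))"

definition bounded_minor :: "nat \<Rightarrow> 'b graph \<Rightarrow> 'a graph \<Rightarrow> bool" where
  "bounded_minor k M G \<longleftrightarrow> simple_graph M \<and>
     (\<exists>B. minor_model B M G \<and> (\<forall>v\<in>verts M. card (B v) \<le> k))"

end

theory Submission
  imports Defs
begin

text \<open>
  If \<open>k \<le> 8 * l\<close>, then \<open>G\<close> itself is the minor in (iii). Otherwise pass to a minimal subgraph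
  with \<open>|E| \<ge> d |V|\<close>, which has minimum degree at least \<open>d\<close>, and let \<open>B\<close> be its set of vertices
  of degree more than \<open>k d\<close>. Among all partitions of \<open>V\<close> into connected pieces of size at most \<open>k\<close>,
  with the vertices of \<open>B\<close> kept as singletons, take one that maximises the number of edges of the
  contracted graph minus \<open>\<epsilon> d\<close> times the sum of \<open>k + 1 + 2 |S|\<^sup>2 / k\<close> over the pieces \<open>S\<close>. Comparing
  with the partition into singletons, contraction loses at most \<open>2 k \<epsilon> d |V|\<close> edges.

  Let \<open>T\<close> be a piece off \<open>B\<close> of size at most \<open>k / 3\<close>. If \<open>T\<close> has at least \<open>\<epsilon> d\<close> adjacent pieces sharing
  about \<open>\<epsilon> d\<close> or more neighbours with it, then \<open>T\<close> together with its neighbouring pieces gives (i). For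
  every other piece \<open>S\<close> off \<open>B\<close> adjacent to \<open>T\<close>, optimality forbids merging \<open>S\<close> with \<open>T\<close>, as well as
  cutting \<open>S\<close> into two connected parts and moving to \<open>T\<close> a part that touches \<open>T\<close> and has at most half
  of \<open>S\<close>. As any two vertices of \<open>S\<close> are separated by such a cut, at most one vertex of \<open>S\<close>, its
  centre, is outside all movable parts. So all but \<open>2 k \<epsilon> d\<close> of the neighbours of a vertex of \<open>T\<close> are
  hubs, that is, members of \<open>B\<close> or centres of pieces of size more than \<open>2 k / 3\<close>. Either the small
  pieces outnumber the hubs \<open>l\<close> times, and representatives of them give (ii), or there are at most
  \<open>8 l |V| / k\<close> pieces and contracting them gives (iii).
\<close>

section \<open>Connectivity expressed through cuts\<close>

definition touch :: "'a set set \<Rightarrow> 'a set \<Rightarrow> 'a set \<Rightarrow> bool" where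
  "touch E S T \<longleftrightarrow> (\<exists>x\<in>S. \<exists>y\<in>T. {x, y} \<in> E)"

text \<open>Connectivity of the subgraph induced on \<open>S\<close>, phrased by crossing edges
  instead of paths: it needs only an edge set, and unions and cuts of pieces can be treated without
  handling walks.\<close>

definition cut_connected :: "'a set set \<Rightarrow> 'a set \<Rightarrow> bool" where
  "cut_connected E S \<longleftrightarrow> S \<noteq> {} \<and> (\<forall>U. U \<subset> S \<longrightarrow> U \<noteq> {} \<longrightarrow> touch E U (S - U))"

lemma touch_sym: "touch E S T \<longleftrightarrow> touch E T S"
  unfolding touch_def by (metis insert_commute)

lemma touch_mono: "touch E S T \<Longrightarrow> S \<subseteq> S' \<Longrightarrow> T \<subseteq> T' \<Longrightarrow> touch E S' T'"
  unfolding touch_def by blast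

lemma touch_Un_right: "touch E R (S \<union> T) \<longleftrightarrow> touch E R S \<or> touch E R T"
  unfolding touch_def by blast

lemma cut_connected_singleton: "cut_connected E {x}"
  unfolding cut_connected_def by blast

text \<open>A set \<open>U\<close> that splits neither part contains one and misses the other, so
  the edge between \<open>S\<close> and \<open>T\<close> crosses it.\<close>

lemma cut_connected_Un:
  assumes S: "cut_connected E S" and T: "cut_connected E T" and ST: "touch E S T"
  shows "cut_connected E (S \<union> T)"
  unfolding cut_connected_def
proof (intro conjI allI impI)
  show "S \<union> T \<noteq> {}" using S by (auto simp: cut_connected_def)
  fix U assume U: "U \<subset> S \<union> T" "U \<noteq> {}"
  consider "U \<inter> S \<noteq> {}" "U \<inter> S \<subset> S" | "U \<inter> T \<noteq> {}" "U \<inter> T \<subset> T"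
    | "S \<subseteq> U" "U \<inter> T = {}" | "T \<subseteq> U" "U \<inter> S = {}"
    using U by blast
  then show "touch E U (S \<union> T - U)"
  proof cases
    case 1
    then have "touch E (U \<inter> S) (S - U \<inter> S)" using S unfolding cut_connected_def by blast
    then show ?thesis by (rule touch_mono) auto
  next
    case 2
    then have "touch E (U \<inter> T) (T - U \<inter> T)" using T unfolding cut_connected_def by blast
    then show ?thesis by (rule touch_mono) auto
  next
    case 3
    then show ?thesis using ST by (intro touch_mono[OF ST]) auto
  next
    case 4
    have "touch E T S" using ST touch_sym by blast
    then show ?thesis by (rule touch_mono) (use 4 in auto)
  qed
qed

lemma cut_connected_separate:
  assumes S: "cut_connected E S" and fin: "finite S" and yz: "y \<in> S" "z \<in> S" "y \<noteq> z"
  obtains A where "A \<subseteq> S" "y \<in> A" "z \<notin> A" "cut_connected E A" "cut_connected E (S - A)"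
proof -
  \<comment> \<open>A maximal such set is the component of \<open>S - {z}\<close> that contains \<open>y\<close>.\<close>
  define F where "F = {A. A \<subseteq> S - {z} \<and> y \<in> A \<and> cut_connected E A}"
  have "finite F" unfolding F_def by (rule finite_subset[of _ "Pow S"]) (use fin in auto)
  moreover have "{y} \<in> F" using yz by (auto simp: cut_connected_singleton F_def)
  ultimately obtain A where "A \<in> F" and mx: "\<forall>A'\<in>F. A \<subseteq> A' \<longrightarrow> A = A'"
    by (meson finite_has_maximal2)
  then have A: "A \<subseteq> S - {z}" "y \<in> A" "cut_connected E A" by (auto simp: F_def)
  \<comment> \<open>Connectivity of \<open>S\<close> gives an edge leaving \<open>U\<close>. If it
    does not end in \<open>S - A\<close>, it ends in \<open>A\<close>, and its end in
    \<open>U\<close> could be added to \<open>A\<close>, against maximality.\<close>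
  have noz: "touch E U (S - A - U)" if U: "U \<subseteq> S - A" "U \<noteq> {}" "z \<notin> U" for U
  proof (rule ccontr)
    assume no: "\<not> ?thesis"
    have "U \<subset> S" using U yz by blast
    then have "touch E U (S - U)" using S U unfolding cut_connected_def by blast
    then obtain u v where uv: "u \<in> U" "v \<in> S - U" "{u, v} \<in> E" unfolding touch_def by blast
    have "v \<in> A" using no uv unfolding touch_def by blast
    then have "touch E A {u}" using uv unfolding touch_def by (metis insert_commute singletonI)
    then have "cut_connected E (A \<union> {u})"
      using A by (intro cut_connected_Un cut_connected_singleton) auto
    then have "A \<union> {u} \<in> F" using A U uv by (auto simp: F_def)
    with mx have "A = A \<union> {u}" by blast
    then show False using uv U by blast
  qed
  have "cut_connected E (S - A)"
    unfolding cut_connected_def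
  proof (intro conjI allI impI)
    show "S - A \<noteq> {}" using A yz by blast
    fix U assume U: "U \<subset> S - A" "U \<noteq> {}"
    show "touch E U (S - A - U)"
    proof (cases "z \<in> U")
      case False
      then show ?thesis using noz U by blast
    next
      case True
      \<comment> \<open>When \<open>U\<close> contains \<open>z\<close>, its complement in
        \<open>S - A\<close> avoids \<open>z\<close>, and crossing edges are symmetric.\<close>
      have "touch E (S - A - U) (S - A - (S - A - U))"
        using noz[of "S - A - U"] U True by blast
      then have "touch E (S - A - (S - A - U)) (S - A - U)" using touch_sym by blast
      then show ?thesis by (rule touch_mono) (use U in auto)
    qed
  qed
  with A that show ?thesis by blast
qed

lemma cut_connected_imp_connected_graph:
  assumes S: "cut_connected E S" and SV: "S \<subseteq> verts G" and EG: "E \<subseteq> edges G"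
  shows "connected_graph (induced_subgraph G S)"
proof -
  let ?R = "{(x, y). {x, y} \<in> {e \<in> edges G. e \<subseteq> S}}"
  have "(u, v) \<in> ?R\<^sup>*" if u: "u \<in> S" and v: "v \<in> S" for u v
  proof (rule ccontr)
    assume nv: "(u, v) \<notin> ?R\<^sup>*"
    let ?U = "{w \<in> S. (u, w) \<in> ?R\<^sup>*}"
    have "?U \<subset> S" "?U \<noteq> {}" using u v nv by auto
    then have "touch E ?U (S - ?U)" using S unfolding cut_connected_def by blast
    then obtain x y where xy: "x \<in> ?U" "y \<in> S - ?U" "{x, y} \<in> E" unfolding touch_def by blast
    then have "(x, y) \<in> ?R" using EG by auto
    then have "(u, y) \<in> ?R\<^sup>*" using xy by (auto intro: rtrancl_into_rtrancl)
    then show False using xy by blast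
  qed
  moreover have "S \<noteq> {}" using S by (simp add: cut_connected_def)
  ultimately show ?thesis using SV
    unfolding connected_graph_def induced_subgraph_def by (auto simp: Int_absorb1)
qed

section \<open>Counting edges of the contracted graph\<close>

text \<open>The pairs are ordered, so every edge of the contracted graph is counted twice; hence the
  factors 2 and the later division by 2.\<close>

definition adj_pairs :: "'a set set \<Rightarrow> 'a set set \<Rightarrow> ('a set \<times> 'a set) set" where
  "adj_pairs E P = {(S, T). S \<in> P \<and> T \<in> P \<and> S \<noteq> T \<and> touch E S T}"

lemma finite_adj_pairs: "finite P \<Longrightarrow> finite (adj_pairs E P)"
  by (rule finite_subset[of _ "P \<times> P"]) (auto simp: adj_pairs_def)

lemma card_adj_pairs_insert:
  assumes "finite Q" "S \<notin> Q"
  shows "card (adj_pairs E (insert S Q)) = card (adj_pairs E Q) + 2 * card {R \<in> Q. touch E R S}"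
proof -
  let ?N = "{R \<in> Q. touch E R S}"
  have eq: "adj_pairs E (insert S Q) = adj_pairs E Q \<union> ((\<lambda>R. (R, S)) ` ?N \<union> (\<lambda>R. (S, R)) ` ?N)"
    using assms(2) touch_sym[of E S] by (auto simp: adj_pairs_def)
  have "card ((\<lambda>R. (R, S)) ` ?N \<union> (\<lambda>R. (S, R)) ` ?N) = card ?N + card ?N"
    using assms by (subst card_Un_disjoint) (auto simp: card_image inj_on_def)
  moreover have "adj_pairs E Q \<inter> ((\<lambda>R. (R, S)) ` ?N \<union> (\<lambda>R. (S, R)) ` ?N) = {}"
    using assms(2) by (auto simp: adj_pairs_def)
  ultimately show ?thesis
    unfolding eq using assms finite_adj_pairs[of Q E] by (subst card_Un_disjoint) auto
qed

lemma card_adj_pairs_eq_sum: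
  assumes "finite P"
  shows "card (adj_pairs E P) = (\<Sum>S\<in>P. card {R \<in> P. R \<noteq> S \<and> touch E R S})"
proof -
  have "adj_pairs E P = (SIGMA S:P. {R \<in> P. R \<noteq> S \<and> touch E R S})"
    using touch_sym[of E] by (auto simp: adj_pairs_def)
  then show ?thesis using assms by simp
qed

text \<open>Merging loses the edge between \<open>S\<close> and \<open>T\<close>, and one of the two
  edges at each common neighbour. The latter is inclusion-exclusion on the two neighbourhoods in
  \<open>Q\<close>.\<close>

lemma card_adj_pairs_merge:
  assumes Q: "finite Q" and ST: "S \<notin> Q" "T \<notin> Q" "S \<noteq> T" "S \<union> T \<notin> Q"
  shows "card (adj_pairs E (insert S (insert T Q)))
    \<le> card (adj_pairs E (insert (S \<union> T) Q)) + 2 * (1 + card {R \<in> Q. touch E R S \<and> touch E R T})"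
proof -
  let ?NS = "{R \<in> Q. touch E R S}" and ?NT = "{R \<in> Q. touch E R T}"
  have "card {R \<in> insert T Q. touch E R S} \<le> card (insert T ?NS)"
    using Q by (intro card_mono) auto
  also have "\<dots> \<le> 1 + card ?NS" using Q ST by simp
  finally have 1: "card {R \<in> insert T Q. touch E R S} \<le> 1 + card ?NS" .
  have "card ?NS + card ?NT = card (?NS \<union> ?NT) + card (?NS \<inter> ?NT)"
    using Q by (intro card_Un_Int) auto
  moreover have "?NS \<union> ?NT = {R \<in> Q. touch E R (S \<union> T)}" by (auto simp: touch_Un_right)
  moreover have "?NS \<inter> ?NT = {R \<in> Q. touch E R S \<and> touch E R T}" by auto
  ultimately show ?thesis using 1 Q ST by (simp add: card_adj_pairs_insert)
qed

text \<open>The edge between \<open>U\<close> and \<open>W\<close> makes up for a possible edge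
  between \<open>S\<close> and \<open>T\<close>. Since the union is unchanged, the same pieces of
  \<open>Q\<close> are adjacent to it, so only common neighbours can cost an edge.\<close>

lemma card_adj_pairs_rearrange:
  assumes Q: "finite Q" and ST: "S \<notin> Q" "T \<notin> Q" "S \<noteq> T"
    and UW: "U \<notin> Q" "W \<notin> Q" "U \<noteq> W" "touch E U W" "U \<union> W = S \<union> T"
  shows "card (adj_pairs E (insert S (insert T Q)))
    \<le> card (adj_pairs E (insert U (insert W Q))) + 2 * card {R \<in> Q. touch E R S \<and> touch E R T}"
proof -
  let ?N = "\<lambda>X. {R \<in> Q. touch E R X}"
  have "card {R \<in> insert T Q. touch E R S} \<le> card (insert T (?N S))"
    using Q by (intro card_mono) auto
  also have "\<dots> \<le> 1 + card (?N S)" using Q ST by simp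
  finally have 1: "card {R \<in> insert T Q. touch E R S} \<le> 1 + card (?N S)" .
  have "{R \<in> insert W Q. touch E R U} = insert W (?N U)" using UW touch_sym[of E U W] by auto
  then have 2: "card {R \<in> insert W Q. touch E R U} = 1 + card (?N U)" using Q UW by simp
  have "card (?N S) + card (?N T) = card (?N S \<union> ?N T) + card (?N S \<inter> ?N T)"
    using Q by (intro card_Un_Int) auto
  moreover have "card (?N S \<union> ?N T) \<le> card (?N U) + card (?N W)"
  proof -
    have "?N S \<union> ?N T = ?N U \<union> ?N W"
      using UW(5) touch_Un_right[of E _ S T] touch_Un_right[of E _ U W] by auto
    then show ?thesis by (simp only: card_Un_le)
  qed
  moreover have "?N S \<inter> ?N T = {R \<in> Q. touch E R S \<and> touch E R T}" by auto
  ultimately show ?thesis using 1 2 Q ST UW by (simp add: card_adj_pairs_insert)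
qed

text \<open>Sending each vertex to its piece maps the ordered edges inside the union onto a set that
  contains all adjacent pairs.\<close>

lemma card_adj_pairs_le:
  assumes disj: "pairwise disjnt P" and fin: "finite (\<Union>P)"
  shows "card (adj_pairs E P) \<le> card {(x, y). x \<in> \<Union>P \<and> y \<in> \<Union>P \<and> {x, y} \<in> E}"
proof -
  define p where "p x = (THE S. S \<in> P \<and> x \<in> S)" for x
  have p: "p x = S" if "S \<in> P" "x \<in> S" for x S
    unfolding p_def using that disj by (intro the_equality) (auto simp: pairwise_def disjnt_def)
  let ?X = "{(x, y). x \<in> \<Union>P \<and> y \<in> \<Union>P \<and> {x, y} \<in> E}"
  have "finite ?X" using fin by (auto intro: finite_subset[of _ "\<Union>P \<times> \<Union>P"])
  moreover have "adj_pairs E P \<subseteq> map_prod p p ` ?X"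
  proof clarify
    fix S T assume ST: "(S, T) \<in> adj_pairs E P"
    then obtain x y where xy: "x \<in> S" "y \<in> T" "{x, y} \<in> E" "S \<in> P" "T \<in> P"
      by (auto simp: adj_pairs_def touch_def)
    then have "(S, T) = map_prod p p (x, y)" by (simp add: p)
    moreover have "(x, y) \<in> ?X" using xy by auto
    ultimately show "(S, T) \<in> map_prod p p ` ?X" by blast
  qed
  ultimately show ?thesis by (rule surj_card_le)
qed

lemma card_edge_pairs:
  assumes "finite E" and "\<forall>e\<in>E. card e = 2"
  shows "card {(x, y). {x, y} \<in> E} = 2 * card E"
  using assms
proof (induction E rule: finite_induct)
  case empty
  then show ?case by simp
next
  case (insert e F)
  then obtain a b where ab: "e = {a, b}" "a \<noteq> b" by (auto simp: card_2_iff)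
  have fin: "finite {(x, y). {x, y} \<in> F}"
  proof (rule finite_subset)
    show "{(x, y). {x, y} \<in> F} \<subseteq> \<Union>F \<times> \<Union>F" by auto
    have "\<forall>e\<in>F. finite e" using insert.prems by (auto intro: card_ge_0_finite)
    then show "finite (\<Union>F \<times> \<Union>F)" using insert.hyps by auto
  qed
  have "{(x, y). {x, y} \<in> insert e F} = {(x, y). {x, y} \<in> F} \<union> {(a, b), (b, a)}"
    using ab by (auto simp: doubleton_eq_iff)
  moreover have "{(x, y). {x, y} \<in> F} \<inter> {(a, b), (b, a)} = {}"
    using ab insert.hyps by (auto simp: insert_commute)
  ultimately have "card {(x, y). {x, y} \<in> insert e F} = card {(x, y). {x, y} \<in> F} + 2"
    using fin ab by (simp add: card_Un_disjoint)
  then show ?case using insert by simp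
qed

text \<open>The handshake identity: sort the ordered edges by their first endpoint.\<close>

lemma card_edge_pairs_eq_sum:
  assumes "finite V" and "\<forall>e\<in>E. e \<subseteq> V \<and> card e = 2"
  shows "2 * card E = (\<Sum>v\<in>V. card {u. {v, u} \<in> E})"
proof -
  have "finite E" using assms by (auto intro: finite_subset[of _ "Pow V"])
  then have "2 * card E = card {(x, y). {x, y} \<in> E}" using card_edge_pairs assms by metis
  also have "{(x, y). {x, y} \<in> E} = (SIGMA v:V. {u. {v, u} \<in> E})" using assms by auto
  also have "card \<dots> = (\<Sum>v\<in>V. card {u. {v, u} \<in> E})"
  proof (rule card_SigmaI)
    show "\<forall>a\<in>V. finite {u. {a, u} \<in> E}"
      using assms by (auto intro!: finite_subset[of _ V])
  qed (use assms in auto)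
  finally show ?thesis .
qed

section \<open>Partitions into branch sets and moves that raise the potential\<close>

text \<open>\<open>B\<close> will hold the vertices of high degree. Keeping them as singletons
  ensures that every other piece has only vertices of bounded degree.\<close>

definition branch_partition ::
    "'a set \<Rightarrow> 'a set set \<Rightarrow> 'a set \<Rightarrow> nat \<Rightarrow> 'a set set \<Rightarrow> bool" where
  "branch_partition V E B k P \<longleftrightarrow> \<Union>P = V \<and> pairwise disjnt P \<and>
     (\<forall>S\<in>P. cut_connected E S \<and> card S \<le> k \<and> (S \<inter> B \<noteq> {} \<longrightarrow> card S = 1))"

text \<open>The first term counts the edges of the contracted graph. Losing a piece saves
  \<open>k + 1\<close>, more than the quadratic term can grow when two pieces of total size at most
  \<open>k\<close> merge; with the number of pieces fixed, the quadratic term rewards equal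
  sizes.\<close>

definition potential :: "'a set set \<Rightarrow> nat \<Rightarrow> real \<Rightarrow> 'a set set \<Rightarrow> real" where
  "potential E k c P = real (card (adj_pairs E P)) / 2
     - c * (\<Sum>S\<in>P. real k + 1 + 2 * (real (card S))\<^sup>2 / real k)"

lemma branch_partition_finite: "branch_partition V E B k P \<Longrightarrow> finite V \<Longrightarrow> finite P"
  unfolding branch_partition_def by (metis finite_UnionD)

lemma branch_partition_memberD:
  assumes "branch_partition V E B k P" "S \<in> P"
  shows "cut_connected E S" "card S \<le> k" "S \<subseteq> V" "S \<noteq> {}"
  using assms unfolding branch_partition_def cut_connected_def by auto

lemma branch_partition_disjoint:
  "branch_partition V E B k P \<Longrightarrow> S \<in> P \<Longrightarrow> T \<in> P \<Longrightarrow> S \<noteq> T \<Longrightarrow> S \<inter> T = {}"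
  unfolding branch_partition_def pairwise_def disjnt_def by auto

lemma branch_partition_fresh:
  assumes "branch_partition V E B k P" "S \<in> P" "T \<in> P" "U \<subseteq> S \<union> T" "U \<noteq> {}"
  shows "U \<notin> P - {S, T}"
  using assms branch_partition_disjoint[OF assms(1), of U S]
    branch_partition_disjoint[OF assms(1), of U T] by blast

text \<open>Serves both moves: \<open>Z\<close> is \<open>{S \<union> T}\<close> when merging, and
  \<open>{T \<union> A, S - A}\<close> when moving \<open>A\<close> from \<open>S\<close> to
  \<open>T\<close>.\<close>

lemma branch_partition_exchange:
  assumes P: "branch_partition V E B k P" and ST: "S \<in> P" "T \<in> P"
    and B: "S \<inter> B = {}" "T \<inter> B = {}" and un: "\<Union>Z = S \<union> T" and Z: "pairwise disjnt Z"
    and conn: "\<And>U. U \<in> Z \<Longrightarrow> cut_connected E U \<and> card U \<le> k"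
  shows "branch_partition V E B k (Z \<union> (P - {S, T}))"
proof -
  have dis: "disjnt U R" if "U \<in> Z" "R \<in> P - {S, T}" for U R
    using that un branch_partition_disjoint[OF P, of R S] branch_partition_disjoint[OF P, of R T] ST
    unfolding disjnt_def by blast
  have "\<Union>(Z \<union> (P - {S, T})) = V" using P ST un unfolding branch_partition_def by auto
  moreover have "pairwise disjnt (Z \<union> (P - {S, T}))"
    using P Z dis disjnt_sym unfolding branch_partition_def pairwise_def by (metis Diff_iff Un_iff)
  moreover have "U \<inter> B = {}" if "U \<in> Z" for U using that un B by blast
  ultimately show ?thesis using conn P unfolding branch_partition_def by auto
qed

text \<open>The merge loses at most one edge plus one per common neighbour, which is less than
  \<open>c\<close>, while the penalty drops by at least \<open>c\<close>.\<close>

lemma potential_merge: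
  assumes P: "branch_partition V E B k P" and V: "finite V" and k: "0 < k" and c: "0 \<le> c"
    and ST: "S \<in> P" "T \<in> P" "S \<noteq> T" "S \<inter> B = {}" "T \<inter> B = {}" and touch: "touch E S T"
    and size: "card S + card T \<le> k"
    and com: "1 + real (card {R \<in> P - {S, T}. touch E R S \<and> touch E R T}) < c"
  obtains P' where "branch_partition V E B k P'" "potential E k c P < potential E k c P'"
proof -
  let ?Q = "P - {S, T}" and ?a = "real (card S)" and ?b = "real (card T)"
  let ?P' = "insert (S \<union> T) ?Q"
  let ?f = "\<lambda>S. real k + 1 + 2 * (real (card S))\<^sup>2 / real k"
  have fin: "finite ?Q" using branch_partition_finite[OF P V] by simp
  note mS = branch_partition_memberD[OF P ST(1)] and mT = branch_partition_memberD[OF P ST(2)]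
  have dST: "S \<inter> T = {}" using branch_partition_disjoint[OF P ST(1-3)] .
  have cardU: "card (S \<union> T) = card S + card T"
    using dST mS mT V by (intro card_Un_disjoint) (auto intro: finite_subset)
  have "branch_partition V E B k ({S \<union> T} \<union> ?Q)"
    using cardU size mS mT touch
    by (intro branch_partition_exchange[OF P ST(1,2,4,5)]) (auto intro: cut_connected_Un)
  then have valid: "branch_partition V E B k ?P'" by simp
  have fresh: "S \<union> T \<notin> ?Q" using mS ST by (intro branch_partition_fresh[OF P]) auto
  have Peq: "P = insert S (insert T ?Q)" using ST by auto
  have "real (card (adj_pairs E P)) / 2
    \<le> real (card (adj_pairs E ?P')) / 2 + (1 + real (card {R \<in> ?Q. touch E R S \<and> touch E R T}))"
    using card_adj_pairs_merge[OF fin, of S T E] fresh ST Peq by (auto simp: field_simps)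
  also have "\<dots> < real (card (adj_pairs E ?P')) / 2 + c" using com by simp
  finally have e: "real (card (adj_pairs E P)) / 2 < real (card (adj_pairs E ?P')) / 2 + c" .
  have s1: "(\<Sum>S\<in>P. ?f S) = ?f S + ?f T + sum ?f ?Q"
    using fin ST by (subst Peq) (simp add: algebra_simps)
  have s2: "(\<Sum>S\<in>?P'. ?f S) = ?f (S \<union> T) + sum ?f ?Q" using fin fresh by simp
  \<comment> \<open>Merging sizes a and b raises the quadratic term by 4ab/k. By the inequality of
    arithmetic and geometric means this is at most k, so 1 remains of the saved
    \<open>k + 1\<close>.\<close>
  have "4 * (?a * ?b) \<le> (?a + ?b)\<^sup>2" using zero_le_power2[of "?a - ?b"]
    by (simp add: power2_eq_square algebra_simps)
  also have "\<dots> \<le> (real k)\<^sup>2"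
    by (rule power_mono) (use size in \<open>auto simp flip: of_nat_add\<close>)
  finally have "4 * (?a * ?b) / real k \<le> real k" using k by (simp add: field_simps power2_eq_square)
  then have "1 \<le> ?f S + ?f T - ?f (S \<union> T)"
    unfolding cardU by (simp add: power2_eq_square algebra_simps add_divide_distrib)
  then have "c * 1 \<le> c * ((\<Sum>S\<in>P. ?f S) - (\<Sum>S\<in>?P'. ?f S))"
    unfolding s1 s2 using c by (intro mult_left_mono) auto
  then have "potential E k c P < potential E k c ?P'"
    using e unfolding potential_def right_diff_distrib by linarith
  with valid that show ?thesis by blast
qed

text \<open>Again fewer than \<open>c\<close> edges are lost. The number of pieces stays the same,
  so the gain of at least \<open>c\<close> must come from the quadratic term alone: \<open>T\<close>
  is so much smaller than \<open>S\<close> that moving \<open>A\<close> evens out the sizes.\<close>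

lemma potential_rebalance:
  assumes P: "branch_partition V E B k P" and V: "finite V" and k: "12 \<le> k" and c: "0 \<le> c"
    and ST: "S \<in> P" "T \<in> P" "S \<noteq> T" "S \<inter> B = {}" "T \<inter> B = {}"
    and A: "A \<subseteq> S" "cut_connected E A" "cut_connected E (S - A)" "touch E A T"
    and size: "k < card S + card T" "3 * card T \<le> k" "2 * card A \<le> card S"
    and com: "1 + real (card {R \<in> P - {S, T}. touch E R S \<and> touch E R T}) < c"
  obtains P' where "branch_partition V E B k P'" "potential E k c P < potential E k c P'"
proof -
  let ?Q = "P - {S, T}"
  let ?U = "T \<union> A" and ?W = "S - A"
  let ?P' = "insert ?U (insert ?W ?Q)"
  let ?f = "\<lambda>S. real k + 1 + 2 * (real (card S))\<^sup>2 / real k"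
  have fin: "finite ?Q" using branch_partition_finite[OF P V] by simp
  note mS = branch_partition_memberD[OF P ST(1)] and mT = branch_partition_memberD[OF P ST(2)]
  have finS: "finite S" "finite T" using mS mT V by (auto intro: finite_subset)
  then have finA: "finite A" using A(1) finite_subset by blast
  have dST: "S \<inter> T = {}" using branch_partition_disjoint[OF P ST(1-3)] .
  have cardU: "card ?U = card T + card A"
    using dST finS finA A(1) by (intro card_Un_disjoint) auto
  have cardA: "card A \<le> card S" using finS A(1) by (intro card_mono) auto
  have cardW: "card ?W = card S - card A" using finA A(1) by (intro card_Diff_subset) auto
  have A0: "A \<noteq> {}" "?W \<noteq> {}" using A by (auto simp: cut_connected_def)
  have x1: "1 \<le> card A" using A0 finA by (simp add: Suc_le_eq card_gt_0_iff)
  have un: "?U \<union> ?W = S \<union> T" using A by auto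
  have UW: "?U \<inter> ?W = {}" using dST A by auto
  have "A \<subset> S" using A A0 by blast
  then have "touch E A ?W" using mS A0 unfolding cut_connected_def by blast
  then have tUW: "touch E ?U ?W" by (rule touch_mono) auto
  have cU: "cut_connected E ?U"
    using A mT touch_sym[of E A T] by (intro cut_connected_Un) auto
  have "branch_partition V E B k ({?U, ?W} \<union> ?Q)"
  proof (rule branch_partition_exchange[OF P ST(1,2,4,5)])
    show "\<Union>{?U, ?W} = S \<union> T" using un by simp
    show "pairwise disjnt {?U, ?W}" using UW by (simp add: pairwise_insert disjnt_def Int_commute)
    show "cut_connected E X \<and> card X \<le> k" if "X \<in> {?U, ?W}" for X
      using that cU A(3) cardU cardW mS(2) size by auto
  qed
  then have valid: "branch_partition V E B k ?P'" by simp
  have freshU: "?U \<notin> ?Q" using mT ST A by (intro branch_partition_fresh[OF P]) auto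
  have freshW: "?W \<notin> ?Q" using ST A0 by (intro branch_partition_fresh[OF P]) auto
  have neUW: "?U \<noteq> ?W" using UW A0 by blast
  have Peq: "P = insert S (insert T ?Q)" using ST by auto
  have "card (adj_pairs E P) \<le> card (adj_pairs E ?P') + 2 * card {R \<in> ?Q. touch E R S \<and> touch E R T}"
    by (subst Peq, rule card_adj_pairs_rearrange)
      (use fin freshU freshW neUW tUW un ST in auto)
  then have "real (card (adj_pairs E P)) / 2
    \<le> real (card (adj_pairs E ?P')) / 2 + real (card {R \<in> ?Q. touch E R S \<and> touch E R T})"
    by linarith
  also have "\<dots> < real (card (adj_pairs E ?P')) / 2 + c" using com by simp
  finally have e: "real (card (adj_pairs E P)) / 2 < real (card (adj_pairs E ?P')) / 2 + c" .
  have s1: "(\<Sum>S\<in>P. ?f S) = ?f S + ?f T + sum ?f ?Q"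
    using fin ST by (subst Peq) (simp add: algebra_simps)
  have s2: "(\<Sum>S\<in>?P'. ?f S) = ?f ?U + ?f ?W + sum ?f ?Q" using fin freshU freshW neUW by simp
  define a b x where "a = real (card T)" and "b = real (card S)" and "x = real (card A)"
  \<comment> \<open>The sizes force |S| > 2k/3, so |T| < |S|/2, while |A| is at most |S|/2.\<close>
  have "card A + card T + 1 \<le> card S" using size by linarith
  then have g: "b - x - a \<ge> 1" "x \<ge> 1" using x1 unfolding a_def b_def x_def by linarith+
  have gap: "3 * (b - a) \<ge> real k" 
  proof -
    have "real k < real (card S + card T)" "real (3 * card T) \<le> real k"
      using size(1,2) by (simp_all only: of_nat_less_iff of_nat_le_iff)
    then show ?thesis unfolding a_def b_def by simp
  qed
  \<comment> \<open>The quadratic term falls by 4p/k. Both factors of p are at least 1, so p is at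
    least their sum minus 1, that is b - a - 1. As b - a is at least k/3, this is at least k/4 once
    k is at least 12.\<close>
  define p where "p = x * (b - x - a)"
  have "0 \<le> (x - 1) * (b - x - a - 1)" using g by (intro mult_nonneg_nonneg) auto
  then have "b - a - 1 \<le> p" by (simp add: p_def algebra_simps)
  moreover have "12 \<le> real k" using k by simp
  ultimately have "real k \<le> 4 * p" using gap by argo
  then have "1 \<le> 4 * p / real k" using k by simp
  also have "\<dots> = ?f S + ?f T - ?f ?U - ?f ?W"
    unfolding cardU cardW of_nat_diff[OF cardA] of_nat_add p_def
      a_def[symmetric] b_def[symmetric] x_def[symmetric]
    using k by (simp add: field_simps power2_eq_square)
  finally have "c * 1 \<le> c * ((\<Sum>S\<in>P. ?f S) - (\<Sum>S\<in>?P'. ?f S))"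
    unfolding s1 s2 using c by (intro mult_left_mono) auto
  then have "potential E k c P < potential E k c ?P'"
    using e unfolding potential_def right_diff_distrib by linarith
  with valid that show ?thesis by blast
qed

section \<open>Optimal partitions and the minors they yield\<close>

lemma branch_partition_singletons:
  assumes "1 \<le> k"
  shows "branch_partition V E B k ((\<lambda>v. {v}) ` V)"
  using assms unfolding branch_partition_def pairwise_def disjnt_def
  by (auto simp: cut_connected_singleton)

lemma card_adj_pairs_singletons:
  assumes "finite V" and "\<forall>e\<in>E. e \<subseteq> V \<and> card e = 2"
  shows "card (adj_pairs E ((\<lambda>v. {v}) ` V)) = 2 * card E"
proof -
  have fin: "finite E" using assms by (auto intro: finite_subset[of _ "Pow V"])
  \<comment> \<open>A loop would give an ordered pair of vertices but no pair of distinct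
    pieces.\<close>
  have "{x} \<notin> E" for x using assms(2) by (metis card_1_singleton_iff One_nat_def n_not_Suc_n numeral_2_eq_2)
  then have "adj_pairs E ((\<lambda>v. {v}) ` V) = (\<lambda>(x, y). ({x}, {y})) ` {(x, y). {x, y} \<in> E}"
    using assms(2) unfolding adj_pairs_def touch_def by (auto simp: image_iff)
  then have "card (adj_pairs E ((\<lambda>v. {v}) ` V)) = card {(x, y). {x, y} \<in> E}"
    by (simp add: card_image inj_on_def split: prod.split)
  then show ?thesis using card_edge_pairs[OF fin] assms by simp
qed

text \<open>There are finitely many partitions, so a maximiser exists. Comparison with singletons
  gives the edge bound: they keep all edges and pay \<open>c * (k + 1 + 2 / k)\<close> per vertex,
  and the penalty of the maximiser is nonnegative.\<close>

lemma ex_optimal_branch_partition: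
  assumes V: "finite V" and E: "\<forall>e\<in>E. e \<subseteq> V \<and> card e = 2" and k: "1 \<le> k" and c: "0 \<le> c"
  obtains P where "branch_partition V E B k P"
    and "\<And>P'. branch_partition V E B k P' \<Longrightarrow> potential E k c P' \<le> potential E k c P"
    and "real (card E) - c * real (card V) * (real k + 1 + 2 / real k) \<le> real (card (adj_pairs E P)) / 2"
proof -
  let ?F = "{P. branch_partition V E B k P}"
  let ?P0 = "(\<lambda>v. {v}) ` V"
  have "?F \<subseteq> Pow (Pow V)" unfolding branch_partition_def by auto
  then have "finite ?F" by (rule finite_subset) (use V in auto)
  moreover have P0: "?P0 \<in> ?F" using branch_partition_singletons[OF k] by blast
  ultimately obtain P where P: "P \<in> ?F"
    and mx: "\<And>P'. P' \<in> ?F \<Longrightarrow> potential E k c P' \<le> potential E k c P"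
    using arg_min_if_finite(1)[of ?F "\<lambda>P. - potential E k c P"]
      arg_min_least[of ?F _ "\<lambda>P. - potential E k c P"] by (metis empty_iff neg_le_iff_le)
  have "potential E k c ?P0 = real (card E) - c * (real (card V) * (real k + 1 + 2 / real k))"
    unfolding potential_def card_adj_pairs_singletons[OF V E]
    by (subst sum.reindex) (auto simp: inj_on_def)
  moreover have "potential E k c P \<le> real (card (adj_pairs E P)) / 2"
    unfolding potential_def using c by (auto intro!: mult_nonneg_nonneg sum_nonneg)
  ultimately have "real (card E) - c * real (card V) * (real k + 1 + 2 / real k)
      \<le> real (card (adj_pairs E P)) / 2"
    using mx[OF P0] by (simp only: mult.assoc)
  with P mx that show ?thesis by blast
qed

lemma card_le_hitting_set:
  assumes disj: "pairwise disjnt Q" and Z: "finite Z" and hit: "\<And>S. S \<in> Q \<Longrightarrow> S \<inter> Z \<noteq> {}"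
  shows "card Q \<le> card Z"
proof -
  define h where "h S = (SOME x. x \<in> S \<inter> Z)" for S
  have h: "h S \<in> S \<inter> Z" if "S \<in> Q" for S
    unfolding h_def using hit[OF that] some_in_eq by blast
  have "inj_on h Q"
  proof (rule inj_onI)
    fix S T assume "S \<in> Q" "T \<in> Q" "h S = h T"
    then have "h S \<in> S \<inter> T" using h by (metis Int_iff)
    then show "S = T" using disj \<open>S \<in> Q\<close> \<open>T \<in> Q\<close> unfolding pairwise_def disjnt_def by blast
  qed
  then show ?thesis using h Z by (intro card_inj_on_le[of h]) auto
qed

text \<open>A chosen representative of each piece serves as a vertex of the minor, which therefore
  has the same vertex type as \<open>G\<close>. The inverse of the choice recovers the branch
  sets.\<close>

lemma bounded_minor_of_branch_partition:
  fixes G :: "'a graph"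
  assumes P: "branch_partition V E B k P" and V: "finite V" "V \<subseteq> verts G" and E: "E \<subseteq> edges G"
  obtains M :: "'a graph" where "bounded_minor k M G" "card (verts M) = card P"
    "2 * card (edges M) = card (adj_pairs E P)"
proof -
  define g where "g S = (SOME x. x \<in> S)" for S :: "'a set"
  have g: "g S \<in> S" if "S \<in> P" for S
    unfolding g_def using branch_partition_memberD(4)[OF P that] by (simp add: some_in_eq)
  have inj: "inj_on g P"
  proof (rule inj_onI)
    fix S T assume "S \<in> P" "T \<in> P" "g S = g T"
    then have "g S \<in> S \<inter> T" using g by (metis Int_iff)
    then show "S = T" using branch_partition_disjoint[OF P] \<open>S \<in> P\<close> \<open>T \<in> P\<close> by blast
  qed
  define Br where "Br = the_inv_into P g"
  have Br: "Br (g S) = S" if "S \<in> P" for S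
    unfolding Br_def using inj that by (rule the_inv_into_f_f)
  define F where "F = {{g S, g T} | S T. (S, T) \<in> adj_pairs E P}"
  define M where "M = Graph (g ` P) F"
  have finP: "finite P" using branch_partition_finite[OF P V(1)] .
  have pairsF: "{(x, y). {x, y} \<in> F} = map_prod g g ` adj_pairs E P"
  proof
    show "{(x, y). {x, y} \<in> F} \<subseteq> map_prod g g ` adj_pairs E P"
    proof clarify
      fix x y assume "{x, y} \<in> F"
      then obtain S T where ST: "(S, T) \<in> adj_pairs E P" "{x, y} = {g S, g T}" unfolding F_def by blast
      moreover have "(T, S) \<in> adj_pairs E P" using ST touch_sym[of E S T] by (auto simp: adj_pairs_def)
      ultimately show "(x, y) \<in> map_prod g g ` adj_pairs E P"
        by (auto simp: doubleton_eq_iff intro: map_prod_imageI)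
    qed
    show "map_prod g g ` adj_pairs E P \<subseteq> {(x, y). {x, y} \<in> F}" unfolding F_def by auto
  qed
  have F: "\<forall>e\<in>F. e \<subseteq> g ` P \<and> card e = 2"
  proof
    fix e assume "e \<in> F"
    then obtain S T where ST: "S \<in> P" "T \<in> P" "S \<noteq> T" "e = {g S, g T}"
      unfolding F_def adj_pairs_def by blast
    then have "g S \<noteq> g T" using inj by (auto dest: inj_onD)
    then show "e \<subseteq> g ` P \<and> card e = 2" using ST by auto
  qed
  have "finite F" using F finP by (auto intro: finite_subset[of _ "Pow (g ` P)"])
  then have "2 * card F = card (map_prod g g ` adj_pairs E P)"
    using card_edge_pairs[of F] F pairsF by simp
  also have "\<dots> = card (adj_pairs E P)"
    using inj by (intro card_image inj_on_subset[OF map_prod_inj_on[OF inj inj]])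
      (auto simp: adj_pairs_def)
  finally have edges: "2 * card (edges M) = card (adj_pairs E P)" by (simp add: M_def)
  have verts: "card (verts M) = card P" using inj by (simp add: M_def card_image)
  have "minor_model Br M G"
    unfolding minor_model_def
  proof (intro conjI ballI allI impI)
    fix v assume "v \<in> verts M"
    then obtain S where S: "S \<in> P" "v = g S" by (auto simp: M_def)
    then show "Br v \<subseteq> verts G" using Br branch_partition_memberD(3)[OF P S(1)] V by auto
    show "connected_graph (induced_subgraph G (Br v))"
      using S Br[OF S(1)] branch_partition_memberD(1,3)[OF P S(1)] V E
      by (metis cut_connected_imp_connected_graph subset_trans)
  next
    fix u v assume "u \<in> verts M" "v \<in> verts M" "u \<noteq> v"
    then obtain S T where "S \<in> P" "T \<in> P" "u = g S" "v = g T" "S \<noteq> T" by (auto simp: M_def)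
    then show "Br u \<inter> Br v = {}" using Br branch_partition_disjoint[OF P] by simp
  next
    fix u v assume "{u, v} \<in> edges M"
    then have "(u, v) \<in> map_prod g g ` adj_pairs E P" using pairsF by (auto simp: M_def)
    then obtain S T where "(S, T) \<in> adj_pairs E P" "u = g S" "v = g T" by auto
    then show "\<exists>x\<in>Br u. \<exists>y\<in>Br v. {x, y} \<in> edges G"
      using Br E unfolding adj_pairs_def touch_def by auto
  qed
  moreover have "\<forall>v\<in>verts M. card (Br v) \<le> k"
    using Br branch_partition_memberD(2)[OF P] by (auto simp: M_def)
  moreover have "simple_graph M" using F finP by (simp add: simple_graph_def M_def)
  ultimately have "bounded_minor k M G" unfolding bounded_minor_def by blast
  with verts edges that show ?thesis by blast
qed

section \<open>Centres of pieces\<close>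

text \<open>An analogue of the centroid of a tree: in every cut of \<open>S\<close> into two
  connected sides, the side of \<open>y\<close> has more than half of the vertices. A piece may have
  no centre.\<close>

definition centre :: "'a set set \<Rightarrow> 'a set \<Rightarrow> 'a \<Rightarrow> bool" where
  "centre E S y \<longleftrightarrow> y \<in> S \<and>
     (\<forall>A\<subseteq>S. y \<in> A \<and> cut_connected E A \<and> cut_connected E (S - A) \<longrightarrow> card S < 2 * card A)"

text \<open>A cut with two connected sides separates distinct \<open>y\<close> and \<open>z\<close>,
  and both sides would contain more than half of \<open>S\<close>.\<close>

lemma centre_unique:
  assumes S: "cut_connected E S" "finite S" and y: "centre E S y" and z: "centre E S z"
  shows "y = z"
proof (rule ccontr)
  assume "y \<noteq> z"
  then obtain A where A: "A \<subseteq> S" "y \<in> A" "z \<notin> A" "cut_connected E A" "cut_connected E (S - A)"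
    using cut_connected_separate[OF S] y z unfolding centre_def by metis
  have "card S < 2 * card A" using y A unfolding centre_def by blast
  moreover have "card S < 2 * card (S - A)"
    using z A unfolding centre_def by (auto simp: double_diff)
  moreover have "card (S - A) = card S - card A"
    using A S by (intro card_Diff_subset) (auto intro: finite_subset)
  ultimately show False by linarith
qed

section \<open>Passing to a subgraph of large minimum degree\<close>

text \<open>Minimise the number of vertices plus edges among subgraphs with at least d edges per
  vertex. Deleting one edge must violate this condition, which bounds the edges from above; deleting
  a vertex of degree below d would preserve it.\<close>

lemma dense_subgraph_min_degree:
  fixes d :: real
  assumes V: "finite V" "V \<noteq> {}" and E: "\<forall>e\<in>E. e \<subseteq> V \<and> card e = 2"
    and d: "0 < d" "d * real (card V) \<le> real (card E)"
  obtains V' E' where "V' \<subseteq> V" "E' \<subseteq> E" "V' \<noteq> {}" "\<forall>e\<in>E'. e \<subseteq> V'"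
    "d * real (card V') \<le> real (card E')" "real (card E') \<le> d * real (card V') + 1"
    "\<forall>v\<in>V'. d \<le> real (card {u. {v, u} \<in> E'})"
proof -
  define F where "F = (\<lambda>(V', E'). V' \<subseteq> V \<and> E' \<subseteq> E \<and> V' \<noteq> {} \<and> (\<forall>e\<in>E'. e \<subseteq> V') \<and>
    d * real (card V') \<le> real (card E'))"
  have "F (V, E)" using assms by (auto simp: F_def)
  then obtain p where p: "F p"
    and mn: "\<And>q. F q \<Longrightarrow> card (fst p) + card (snd p) \<le> card (fst q) + card (snd q)"
    using ex_has_least_nat[of F "(V, E)" "\<lambda>q. card (fst q) + card (snd q)"] by blast
  obtain V' E' where pe: "p = (V', E')" by (cases p)
  have VE: "V' \<subseteq> V" "E' \<subseteq> E" "V' \<noteq> {}" "\<forall>e\<in>E'. e \<subseteq> V'"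
    "d * real (card V') \<le> real (card E')" using p by (auto simp: pe F_def)
  have finE: "finite E" by (rule finite_subset[of _ "Pow V"]) (use V E in auto)
  have fin: "finite V'" "finite E'" using finite_subset[OF VE(1) V(1)] finite_subset[OF VE(2) finE] .
  have V1: "0 < card V'" using fin VE by (simp add: card_gt_0_iff)
  have "0 < d * real (card V')" using d V1 by simp
  then have "0 < card E'" using VE(5) by linarith
  then obtain e where e: "e \<in> E'" by (metis card.empty ex_in_conv less_irrefl)
  have up: "real (card E') \<le> d * real (card V') + 1"
  proof (rule ccontr)
    assume "\<not> ?thesis"
    then have "F (V', E' - {e})" using VE e fin by (auto simp: F_def card_Diff_singleton of_nat_diff)
    from mn[OF this] show False using e fin \<open>0 < card E'\<close> by (simp add: pe card_Diff_singleton)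
  qed
  have "d \<le> real (card {u. {v, u} \<in> E'})" if v: "v \<in> V'" for v
  proof (rule ccontr)
    assume small: "\<not> ?thesis"
    let ?E = "{f \<in> E'. v \<notin> f}"
    have "{f \<in> E'. v \<in> f} \<subseteq> (\<lambda>u. {v, u}) ` {u. {v, u} \<in> E'}"
    proof
      fix f assume f: "f \<in> {f \<in> E'. v \<in> f}"
      then have "card f = 2" using VE E by auto
      then obtain a b where "f = {a, b}" by (auto simp: card_2_iff)
      then show "f \<in> (\<lambda>u. {v, u}) ` {u. {v, u} \<in> E'}" using f by (auto simp: insert_commute)
    qed
    moreover have "finite {u. {v, u} \<in> E'}" using VE fin by (auto intro!: finite_subset[of _ V'])
    ultimately have le: "card {f \<in> E'. v \<in> f} \<le> card {u. {v, u} \<in> E'}" by (rule surj_card_le[rotated])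
    have "E' = ?E \<union> {f \<in> E'. v \<in> f}" by auto
    then have "card E' \<le> card ?E + card {f \<in> E'. v \<in> f}" by (metis card_Un_le)
    then have many: "real (card E') - d < real (card ?E)" using le small by linarith
    \<comment> \<open>The smaller subgraph must keep a vertex to be a competitor; the edge
      \<open>e\<close> has an end other than \<open>v\<close>.\<close>
    have ne: "V' - {v} \<noteq> {}"
    proof
      assume "V' - {v} = {}"
      then have "e \<subseteq> {v}" using e VE(4) by blast
      then have "card e \<le> 1" using card_mono[of "{v}" e] by simp
      then show False using e VE E by fastforce
    qed
    have "real (card (V' - {v})) = real (card V') - 1" using v fin V1 by (simp add: of_nat_diff)
    then have "d * real (card (V' - {v})) = d * real (card V') - d"
      by (simp only: right_diff_distrib mult_1_right)
    then have "d * real (card (V' - {v})) \<le> real (card ?E)" using VE(5) many by linarith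
    moreover have "V' - {v} \<subseteq> V" "?E \<subseteq> E" "\<forall>f\<in>?E. f \<subseteq> V' - {v}" using VE(1,2,4) by blast+
    ultimately have "F (V' - {v}, ?E)" using ne by (simp add: F_def)
    from mn[OF this] have "card V' + card E' \<le> card (V' - {v}) + card ?E" by (simp add: pe)
    moreover have "card ?E \<le> card E'" using fin by (intro card_mono) auto
    moreover have "card (V' - {v}) < card V'" using v fin by (meson card_Diff1_less)
    ultimately show False by linarith
  qed
  with VE up that show ?thesis by blast
qed

section \<open>Structure of an optimal partition\<close>

text \<open>\<open>c\<close> will be \<open>\<epsilon> * d\<close> and \<open>B\<close> the set of
  vertices of degree above \<open>k * d\<close>; no degree condition is fixed here.\<close>

locale optimal_branch_partition =
  fixes V :: "'a set" and E :: "'a set set" and B :: "'a set" and k :: nat and c :: real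
    and P :: "'a set set"
  assumes finite_V: "finite V" and edges: "\<forall>e\<in>E. e \<subseteq> V \<and> card e = 2" and B_subset: "B \<subseteq> V"
    and k12: "12 \<le> k" and c_nonneg: "0 \<le> c" and partition: "branch_partition V E B k P"
    and optimal: "\<And>P'. branch_partition V E B k P' \<Longrightarrow> potential E k c P' \<le> potential E k c P"
begin

definition common :: "'a set \<Rightarrow> 'a set \<Rightarrow> 'a set set" where
  "common S T = {R \<in> P - {S, T}. touch E R S \<and> touch E R T}"

text \<open>The last condition negates the hypothesis on common neighbours in the two moves: mates
  of \<open>T\<close> are the adjacent pieces for which the moves are not known to gain.\<close>

definition mates :: "'a set \<Rightarrow> 'a set set" where
  "mates T = {S \<in> P. S \<noteq> T \<and> touch E S T \<and> c \<le> 1 + real (card (common S T))}"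

definition small :: "'a set set" where
  "small = {T \<in> P. T \<inter> B = {} \<and> 3 * card T \<le> k}"

definition large :: "'a set set" where
  "large = {S \<in> P. S \<inter> B = {} \<and> 2 * k < 3 * card S}"

definition hubs :: "'a set" where
  "hubs = B \<union> {y. \<exists>S\<in>large. centre E S y}"

lemma finite_P: "finite P"
  using branch_partition_finite[OF partition finite_V] .

lemma finite_piece: "S \<in> P \<Longrightarrow> finite S"
  using branch_partition_memberD(3)[OF partition] finite_V finite_subset by blast

lemma disjoint_pieces: "Q \<subseteq> P \<Longrightarrow> pairwise disjnt Q"
  using partition pairwise_subset unfolding branch_partition_def by blast

lemma finite_neighbors: "finite {u. {t, u} \<in> E}"
  using edges finite_V by (auto intro!: finite_subset[of _ V])

text \<open>If the sizes add up to at most \<open>k\<close>, merging gains; hence \<open>S\<close>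
  has more than 2k/3 vertices. If \<open>y\<close> lies in a movable part with at most half of
  \<open>S\<close>, that part touches \<open>T\<close> through \<open>y\<close>, and moving it
  gains.\<close>

lemma small_neighbor_centre:
  assumes T: "T \<in> small" and S: "S \<in> P" "S \<noteq> T" "S \<inter> B = {}" "S \<notin> mates T"
    and ty: "t \<in> T" "y \<in> S" "{t, y} \<in> E"
  shows "S \<in> large" "centre E S y"
proof -
  have T': "T \<in> P" "T \<inter> B = {}" "3 * card T \<le> k" using T by (auto simp: small_def)
  have touch: "touch E S T" using ty unfolding touch_def by (metis insert_commute)
  then have com: "1 + real (card {R \<in> P - {S, T}. touch E R S \<and> touch E R T}) < c"
    using S by (auto simp: mates_def common_def)
  have size: "k < card S + card T"
  proof (rule ccontr)
    assume "\<not> ?thesis"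
    then obtain P' where "branch_partition V E B k P'" "potential E k c P < potential E k c P'"
      using potential_merge[OF partition finite_V _ c_nonneg S(1) T'(1) S(2,3) T'(2) touch _ com] k12
      by auto
    then show False using optimal[of P'] by simp
  qed
  then show "S \<in> large" using S T' by (auto simp: large_def)
  show "centre E S y"
    unfolding centre_def
  proof (intro conjI allI impI)
    show "y \<in> S" by fact
    fix A assume A: "A \<subseteq> S" "y \<in> A \<and> cut_connected E A \<and> cut_connected E (S - A)"
    show "card S < 2 * card A"
    proof (rule ccontr)
      assume "\<not> ?thesis"
      then have le: "2 * card A \<le> card S" by simp
      have "touch E A T" using ty A unfolding touch_def by (metis insert_commute)
      then obtain P' where "branch_partition V E B k P'" "potential E k c P < potential E k c P'"
        using potential_rebalance[OF partition finite_V k12 c_nonneg S(1) T'(1) S(2,3) T'(2) A(1)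
          _ _ _ size T'(3) le com] A by blast
      then show False using optimal[of P'] by simp
    qed
  qed
qed

text \<open>A neighbour of \<open>t\<close> lies in \<open>T\<close>, in a mate of \<open>T\<close>,
  in \<open>B\<close>, or in another piece, where it must be the centre of a large piece.\<close>

lemma degree_le_hub_degree:
  assumes T: "T \<in> small" and t: "t \<in> T"
  shows "card {u. {t, u} \<in> E} \<le> card T + k * card (mates T) + card ({u. {t, u} \<in> E} \<inter> hubs)"
proof -
  let ?N = "{u. {t, u} \<in> E}"
  have TP: "T \<in> P" using T by (simp add: small_def)
  have MP: "mates T \<subseteq> P" by (auto simp: mates_def)
  have "?N \<subseteq> T \<union> \<Union>(mates T) \<union> (?N \<inter> hubs)"
  proof
    fix y assume y: "y \<in> ?N"
    then have "y \<in> V" using edges by auto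
    then obtain S where S: "S \<in> P" "y \<in> S" using partition by (auto simp: branch_partition_def)
    consider "S = T" | "S \<in> mates T" | "y \<in> B" | "S \<noteq> T" "S \<notin> mates T" "y \<notin> B" by blast
    then show "y \<in> T \<union> \<Union>(mates T) \<union> (?N \<inter> hubs)"
    proof cases
      case 4
      \<comment> \<open>A piece that meets \<open>B\<close> is a singleton, so it would be
        \<open>{y}\<close> with \<open>y\<close> in \<open>B\<close>.\<close>
      have "S \<inter> B = {}"
      proof (rule ccontr)
        assume "S \<inter> B \<noteq> {}"
        then have "card S = 1" "S \<inter> B \<noteq> {}" using partition S by (auto simp: branch_partition_def)
        then show False using S 4 by (auto simp: card_1_singleton_iff)
      qed
      then have "S \<in> large" "centre E S y"
        using small_neighbor_centre[OF T S(1) 4(1) _ 4(2) t S(2)] y by auto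
      then show ?thesis using y by (auto simp: hubs_def)
    qed (use S y in \<open>auto simp: hubs_def\<close>)
  qed
  moreover have fin: "finite (\<Union>(mates T))"
    using MP finite_P finite_piece by (auto intro: finite_subset)
  ultimately have "card ?N \<le> card (T \<union> \<Union>(mates T) \<union> (?N \<inter> hubs))"
    using finite_neighbors finite_piece[OF TP] by (intro card_mono) auto
  also have "\<dots> \<le> card T + card (\<Union>(mates T)) + card (?N \<inter> hubs)"
    using card_Un_le[of "T \<union> \<Union>(mates T)" "?N \<inter> hubs"] card_Un_le[of T "\<Union>(mates T)"] by linarith
  also have "card (\<Union>(mates T)) \<le> (\<Sum>S\<in>mates T. card S)" by (rule card_Union_le_sum_card)
  also have "\<dots> \<le> card (mates T) * k"
    using MP branch_partition_memberD(2)[OF partition] by (intro sum_bounded_above[of _ card k, simplified]) auto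
  finally show ?thesis by (simp add: mult.commute)
qed

text \<open>\<open>W\<close> consists of \<open>T\<close> and all its adjacent pieces. There are at
  most \<open>k * D\<close> of these, as each contains a neighbour of \<open>T\<close>. The many
  common neighbours of \<open>T\<close> and its mates make \<open>W\<close> dense.\<close>

lemma many_mates_dense:
  assumes T: "T \<in> P" and D: "\<And>t. t \<in> T \<Longrightarrow> real (card {u. {t, u} \<in> E}) \<le> D"
    and mates: "c \<le> real (card (mates T))"
  obtains W where "W \<subseteq> V" "real (card W) \<le> real k + real k * (real k * D)"
    "c\<^sup>2 / 2 \<le> real (card {e \<in> E. e \<subseteq> W})"
proof -
  define N where "N = {S \<in> P. S \<noteq> T \<and> touch E S T}"
  define W where "W = \<Union>(insert T N)"
  have NP: "N \<subseteq> P" by (auto simp: N_def)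
  have finN: "finite N" using NP finite_P finite_subset by blast
  have TN: "T \<notin> N" by (simp add: N_def)
  have WV: "W \<subseteq> V" using NP T branch_partition_memberD(3)[OF partition] by (auto simp: W_def)
  have finW: "finite W" using WV finite_V finite_subset by blast
  let ?Z = "\<Union>t\<in>T. {u. {t, u} \<in> E}"
  have "card N \<le> card ?Z"
  proof (rule card_le_hitting_set)
    show "finite ?Z" using finite_piece[OF T] finite_neighbors by blast
    fix S assume "S \<in> N"
    then obtain x t where "x \<in> S" "t \<in> T" "{t, x} \<in> E"
      unfolding N_def touch_def by (auto simp: insert_commute)
    then show "S \<inter> ?Z \<noteq> {}" by blast
  qed (rule disjoint_pieces[OF NP])
  also have "\<dots> \<le> (\<Sum>t\<in>T. card {u. {t, u} \<in> E})" using finite_piece[OF T] by (rule card_UN_le)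
  finally have "real (card N) \<le> (\<Sum>t\<in>T. real (card {u. {t, u} \<in> E}))"
    by (metis of_nat_le_iff of_nat_sum)
  also have "\<dots> \<le> real (card T) * D" using D by (intro sum_bounded_above) auto
  also have "\<dots> \<le> real k * D"
  proof (rule mult_right_mono)
    show "real (card T) \<le> real k" using branch_partition_memberD(2)[OF partition T] by simp
    obtain t where "t \<in> T" using branch_partition_memberD(4)[OF partition T] by blast
    then show "0 \<le> D" using D[of t] by linarith
  qed
  finally have N: "real (card N) \<le> real k * D" .
  have "card W \<le> (\<Sum>S\<in>insert T N. card S)" unfolding W_def by (rule card_Union_le_sum_card)
  also have "\<dots> \<le> card (insert T N) * k"
    using NP T branch_partition_memberD(2)[OF partition]
    by (intro sum_bounded_above[of _ card k, simplified]) auto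
  finally have "card W \<le> k + k * card N" using TN finN by (simp add: algebra_simps)
  then have "real (card W) \<le> real k + real k * real (card N)" by (metis of_nat_add of_nat_le_iff of_nat_mult)
  also have "\<dots> \<le> real k + real k * (real k * D)" using N by (intro add_left_mono mult_left_mono) auto
  finally have cardW: "real (card W) \<le> real k + real k * (real k * D)" .
  have MN: "mates T \<subseteq> N" by (auto simp: mates_def N_def)
  \<comment> \<open>Common neighbours of \<open>T\<close> and a mate are themselves in
    \<open>N\<close>, so each mate has at least \<open>c - 1\<close> neighbours inside
    \<open>N\<close>.\<close>
  have "real (card (mates T)) * (c - 1) \<le> (\<Sum>S\<in>mates T. real (card {R \<in> N. R \<noteq> S \<and> touch E R S}))"
  proof (rule sum_bounded_below)
    fix S assume S: "S \<in> mates T"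
    have "common S T \<subseteq> {R \<in> N. R \<noteq> S \<and> touch E R S}" by (auto simp: common_def N_def)
    then have "card (common S T) \<le> card {R \<in> N. R \<noteq> S \<and> touch E R S}" using finN by (intro card_mono) auto
    then show "c - 1 \<le> real (card {R \<in> N. R \<noteq> S \<and> touch E R S})" using S by (auto simp: mates_def)
  qed
  also have "\<dots> \<le> (\<Sum>S\<in>N. real (card {R \<in> N. R \<noteq> S \<and> touch E R S}))"
    using finN MN by (intro sum_mono2) auto
  also have "\<dots> = real (card (adj_pairs E N))" using card_adj_pairs_eq_sum[OF finN] by simp
  finally have adjN: "real (card (mates T)) * (c - 1) \<le> real (card (adj_pairs E N))" .
  have "card (mates T) \<le> card N" using MN finN by (rule card_mono[rotated])
  moreover have "{R \<in> N. touch E R T} = N" by (auto simp: N_def)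
  \<comment> \<open>Adjacencies with \<open>T\<close> itself add two ordered pairs for each member
    of \<open>N\<close>, which raises the factor from \<open>c - 1\<close> to \<open>c + 1\<close>
    and so gives at least \<open>c * c\<close> ordered pairs.\<close>
  ultimately have "real (card (mates T)) * (c - 1) + 2 * real (card (mates T))
      \<le> real (card (adj_pairs E (insert T N)))"
    using adjN card_adj_pairs_insert[OF finN TN, of E] by simp
  moreover have "card (adj_pairs E (insert T N)) \<le> 2 * card {e \<in> E. e \<subseteq> W}"
  proof -
    have "card (adj_pairs E (insert T N)) \<le> card {(x, y). x \<in> W \<and> y \<in> W \<and> {x, y} \<in> E}"
      unfolding W_def using T NP finW
      by (intro card_adj_pairs_le disjoint_pieces) (auto simp: W_def)
    also have "{(x, y). x \<in> W \<and> y \<in> W \<and> {x, y} \<in> E} = {(x, y). {x, y} \<in> {e \<in> E. e \<subseteq> W}}" by auto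
    also have "card \<dots> = 2 * card {e \<in> E. e \<subseteq> W}"
    proof (rule card_edge_pairs)
      show "finite {e \<in> E. e \<subseteq> W}" by (rule finite_subset[of _ "Pow W"]) (use finW in auto)
    qed (use edges in auto)
    finally show ?thesis .
  qed
  moreover have "c * c \<le> real (card (mates T)) * (c + 1)"
    using mates c_nonneg by (intro mult_mono) auto
  ultimately have "c\<^sup>2 / 2 \<le> real (card {e \<in> E. e \<subseteq> W})"
    by (simp add: power2_eq_square algebra_simps)
  with WV cardW that show ?thesis by blast
qed

text \<open>Uniqueness of centres: each large piece contributes at most one hub.\<close>

lemma card_hubs_le: "card hubs \<le> card B + card large"
proof -
  have fin: "finite large" using finite_P by (simp add: large_def)
  have "{y. \<exists>S\<in>large. centre E S y} \<subseteq> (\<lambda>S. THE y. centre E S y) ` large"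
  proof clarify
    fix y S assume S: "S \<in> large" "centre E S y"
    then have SP: "S \<in> P" by (simp add: large_def)
    have "(THE y. centre E S y) = y"
      using S(2) centre_unique[OF branch_partition_memberD(1)[OF partition SP] finite_piece[OF SP]]
      by (intro the_equality) auto
    then show "y \<in> (\<lambda>S. THE y. centre E S y) ` large" using S by force
  qed
  then have "card {y. \<exists>S\<in>large. centre E S y} \<le> card large" by (rule surj_card_le[OF fin])
  then show ?thesis unfolding hubs_def using card_Un_le[of B "{y. \<exists>S\<in>large. centre E S y}"] by linarith
qed

text \<open>The factor 3 avoids dividing \<open>k\<close>: \<open>m\<close> is \<open>k\<close> for
  pieces of size at least k/3, and \<open>2 * k\<close> for large pieces.\<close>

lemma card_pieces_le:
  assumes Q: "Q \<subseteq> P" and m: "\<And>S. S \<in> Q \<Longrightarrow> m \<le> 3 * card S"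
  shows "m * card Q \<le> 3 * card V"
proof -
  have finQ: "finite Q" using Q finite_P finite_subset by blast
  have "card Q * m \<le> (\<Sum>S\<in>Q. 3 * card S)" using sum_bounded_below[of Q m "\<lambda>S. 3 * card S"] m by simp
  also have "\<dots> = 3 * card (\<Union>Q)"
    using Q finite_piece disjoint_pieces[OF Q]
    by (subst card_Union_disjoint) (auto simp: sum_distrib_left)
  also have "\<dots> \<le> 3 * card V"
    using Q finite_V branch_partition_memberD(3)[OF partition] by (intro mult_left_mono card_mono) auto
  finally show ?thesis by (simp add: mult.commute)
qed

text \<open>A piece meets \<open>B\<close>, or is small, or has at least k/3 vertices; by
  disjointness there are at most |B| of the first kind and 3|V|/k of the last.\<close>

lemma card_partition_le:
  "real k * real (card P) \<le> real k * (real (card B) + real (card small)) + 3 * real (card V)"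
proof -
  let ?PB = "{S \<in> P. S \<inter> B \<noteq> {}}" and ?M = "{S \<in> P. k \<le> 3 * card S}"
  have "P \<subseteq> ?PB \<union> small \<union> ?M" by (auto simp: small_def)
  then have "card P \<le> card (?PB \<union> small \<union> ?M)" using finite_P by (intro card_mono) (auto simp: small_def)
  also have "\<dots> \<le> card ?PB + card small + card ?M"
    using card_Un_le[of "?PB \<union> small" ?M] card_Un_le[of ?PB small] by linarith
  also have "card ?PB \<le> card B"
    using B_subset finite_V by (intro card_le_hitting_set disjoint_pieces) (auto intro: finite_subset)
  finally have "k * card P \<le> k * (card B + card small + card ?M)" by simp
  also have "\<dots> = k * (card B + card small) + k * card ?M" by (simp add: algebra_simps)
  also have "k * card ?M \<le> 3 * card V" by (rule card_pieces_le) auto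
  finally have "real (k * card P) \<le> real (k * (card B + card small) + 3 * card V)"
    by (simp only: of_nat_le_iff)
  then show ?thesis by simp
qed

lemma card_large_le: "2 * real k * real (card large) \<le> 3 * real (card V)"
proof -
  have "(2 * k) * card large \<le> 3 * card V" by (rule card_pieces_le) (auto simp: large_def)
  then have "real ((2 * k) * card large) \<le> real (3 * card V)" by (simp only: of_nat_le_iff)
  then show ?thesis by simp
qed

end

section \<open>The three outcomes for a graph of large minimum degree\<close>

lemma min_degree_trichotomy:
  fixes k l :: nat and \<epsilon> d :: real and V :: "'a set"
  assumes V: "finite V" "V \<noteq> {}" and E: "\<forall>e\<in>E. e \<subseteq> V \<and> card e = 2"
    and l: "2 \<le> l" and k: "12 \<le> k" and \<epsilon>: "0 < \<epsilon>" "\<epsilon> < 1 / (4 * real k)" and d: "1 / \<epsilon> \<le> d"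
    and deg: "\<forall>v\<in>V. d \<le> real (card {u. {v, u} \<in> E})"
    and dens: "d * real (card V) \<le> real (card E)" "real (card E) \<le> d * real (card V) + 1"
  shows "(\<exists>W\<subseteq>V. real (card W) \<le> 3 * real k ^ 3 * d
            \<and> real (card {e \<in> E. e \<subseteq> W}) \<ge> \<epsilon>\<^sup>2 * d\<^sup>2 / 2)
       \<or> (\<exists>X Y. X \<subseteq> V \<and> Y \<subseteq> V \<and> X \<inter> Y = {} \<and> card X > l * card Y
            \<and> (\<forall>x\<in>X. real (card ({u. {x, u} \<in> E} \<inter> Y)) \<ge> (1 - 2 * real k * \<epsilon>) * d))
       \<or> (\<exists>B P. branch_partition V E B k P
            \<and> real (card (adj_pairs E P)) / 2
              \<ge> real k / (8 * real l) * (1 - 2 * real k * \<epsilon>) * d * real (card P))"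
proof -
  define n c K L where "n = real (card V)" and "c = \<epsilon> * d" and "K = real k" and "L = real l"
  have K: "12 \<le> K" using k by (simp add: K_def)
  have L: "2 \<le> L" using l by (simp add: L_def)
  have n: "1 \<le> n" using V by (simp add: n_def Suc_le_eq card_gt_0_iff)
  have c1: "1 \<le> c" using \<epsilon> d by (simp add: c_def field_simps)
  have Ke: "4 * K * \<epsilon> < 1" using \<epsilon> K by (simp add: K_def field_simps)
  \<comment> \<open>A lower bound on d lets the additive 1 in the edge bound be absorbed
    later.\<close>
  have "4 * K < 1 / \<epsilon>" using Ke \<epsilon>(1) by (simp add: field_simps)
  then have d8: "8 \<le> d" using d K by linarith
  define B where "B = {v \<in> V. K * d < real (card {u. {v, u} \<in> E})}"
  obtain P where P: "branch_partition V E B k P"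
    and opt: "\<And>P'. branch_partition V E B k P' \<Longrightarrow> potential E k c P' \<le> potential E k c P"
    and adj: "real (card E) - c * real (card V) * (real k + 1 + 2 / real k) \<le> real (card (adj_pairs E P)) / 2"
    using ex_optimal_branch_partition[OF V(1) E, of k c B] k c1 by auto
  interpret optimal_branch_partition V E B k c P
    by unfold_locales (use V E k c1 P opt in \<open>auto simp: B_def\<close>)
  consider (mates) T where "T \<in> small" "c \<le> real (card (mates T))"
    | (hubs) "\<forall>T\<in>small. real (card (mates T)) < c" "l * card hubs < card small"
    | (few) "card small \<le> l * card hubs"
    by (meson not_le)
  then show ?thesis
  proof cases
    case mates
    have T: "T \<in> P" "T \<inter> B = {}" using mates by (auto simp: small_def)
    have D: "real (card {u. {t, u} \<in> E}) \<le> K * d" if "t \<in> T" for t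
      using that T branch_partition_memberD(3)[OF P T(1)] by (force simp: B_def)
    obtain W where W: "W \<subseteq> V" "real (card W) \<le> real k + real k * (real k * (K * d))"
      "c\<^sup>2 / 2 \<le> real (card {e \<in> E. e \<subseteq> W})"
      by (rule many_mates_dense[OF T(1) D mates(2)])
    \<comment> \<open>The size of \<open>W\<close> is at most k + k^3 d, and k is at most k^3
      d.\<close>
    have "K * 1 \<le> K * (K * K * d)"
    proof (rule mult_left_mono)
      have "1 * 1 * 1 \<le> K * K * d" using K d8 by (intro mult_mono) auto
      then show "1 \<le> K * K * d" by simp
    qed (use K in simp)
    moreover have "0 \<le> K * K * K * d" using K d8 by simp
    ultimately have "real (card W) \<le> 3 * real k ^ 3 * d"
      using W(2) by (simp add: K_def[symmetric] power3_eq_cube algebra_simps)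
    moreover have "\<epsilon>\<^sup>2 * d\<^sup>2 / 2 = c\<^sup>2 / 2" by (simp add: c_def power_mult_distrib)
    ultimately show ?thesis using W(1,3) by auto
  next
    case hubs
    \<comment> \<open>One representative per small piece forms \<open>X\<close>, and the hubs form
      \<open>Y\<close>.\<close>
    define g where "g S = (SOME x. x \<in> S)" for S :: "'a set"
    have g: "g S \<in> S" if "S \<in> P" for S
      unfolding g_def using branch_partition_memberD(4)[OF P that] by (simp add: some_in_eq)
    have sP: "small \<subseteq> P" by (auto simp: small_def)
    have "inj_on g small"
    proof (rule inj_onI)
      fix S T assume ST: "S \<in> small" "T \<in> small" "g S = g T"
      then have "g S \<in> S \<inter> T" using g sP by (metis Int_iff subsetD)
      then show "S = T" using branch_partition_disjoint[OF P] ST sP by blast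
    qed
    then have "l * card hubs < card (g ` small)" using hubs(2) by (simp add: card_image)
    moreover have "g ` small \<subseteq> V" using g sP branch_partition_memberD(3)[OF P] by blast
    moreover have "hubs \<subseteq> V"
      using branch_partition_memberD(3)[OF P] B_subset
      unfolding hubs_def large_def centre_def by blast
    moreover have "g ` small \<inter> hubs = {}"
    proof -
      have "g T \<notin> hubs" if T: "T \<in> small" for T
      proof
        assume h: "g T \<in> hubs"
        have gT: "g T \<in> T" using g T sP by blast
        then have "g T \<notin> B" using T by (auto simp: small_def)
        then obtain S where S: "S \<in> large" "g T \<in> S" using h by (auto simp: hubs_def centre_def)
        then have "S = T" using branch_partition_disjoint[OF P, of S T] gT T sP by (auto simp: large_def)
        then show False using S T k by (auto simp: large_def small_def)
      qed
      then show ?thesis by blast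
    qed
    moreover have "(1 - 2 * real k * \<epsilon>) * d \<le> real (card ({u. {x, u} \<in> E} \<inter> hubs))"
      if xs: "x \<in> g ` small" for x
    proof -
      obtain T where T: "T \<in> small" "x = g T" using xs by blast
      have x: "x \<in> T" using T g sP by blast
      then have "x \<in> V" using T sP branch_partition_memberD(3)[OF P] by blast
      then have "d \<le> real (card {u. {x, u} \<in> E})" using deg by blast
      also have "\<dots> \<le> real (card T + k * card (mates T) + card ({u. {x, u} \<in> E} \<inter> hubs))"
        using degree_le_hub_degree[OF T(1) x] by (simp only: of_nat_le_iff)
      finally have "d \<le> real (card T) + K * real (card (mates T)) + real (card ({u. {x, u} \<in> E} \<inter> hubs))"
        by (simp add: K_def)
      \<comment> \<open>Both losses, |T| and the vertices in mates, are at most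
        \<open>K * c\<close>; for |T| this uses that \<open>c\<close> is at least 1. Together they
        give the term \<open>2 * k * \<epsilon> * d\<close>.\<close>
      moreover have "real (card T) \<le> K * 1" using T branch_partition_memberD(2)[OF P] sP by (auto simp: K_def)
      moreover have "K * 1 \<le> K * c" using c1 K by (intro mult_left_mono) auto
      moreover have "K * real (card (mates T)) \<le> K * c"
        using hubs(1) T K by (intro mult_left_mono) (auto intro: less_imp_le)
      moreover have "(1 - 2 * real k * \<epsilon>) * d = d - 2 * (K * c)" by (simp add: c_def K_def algebra_simps)
      ultimately show ?thesis by linarith
    qed
    ultimately show ?thesis by (intro disjI2 disjI1 exI[of _ "g ` small"] exI[of _ hubs]) auto
  next
    case few
    define b q s N where "b = real (card B)" and "q = real (card large)"
      and "s = real (card small)" and "N = real (card P)"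
    \<comment> \<open>The degree sum bounds \<open>B\<close>: it is at most 2dn + 2, and dn at least
      8 turns this into 9dn/4.\<close>
    have "b * (K * d) \<le> (\<Sum>v\<in>B. real (card {u. {v, u} \<in> E}))"
      unfolding b_def by (rule sum_bounded_below) (auto simp: B_def)
    also have "\<dots> \<le> (\<Sum>v\<in>V. real (card {u. {v, u} \<in> E}))"
      using V B_subset by (intro sum_mono2) auto
    also have "\<dots> = 2 * real (card E)"
      using arg_cong[OF card_edge_pairs_eq_sum[OF V(1) E], of real] by simp
    also have "\<dots> \<le> 2 * (d * n + 1)" using dens(2) by (simp add: n_def)
    also have "\<dots> \<le> d * (9 / 4 * n)"
    proof -
      have "8 * 1 \<le> d * n" using d8 n by (intro mult_mono) auto
      then show ?thesis by simp
    qed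
    finally have "d * (K * b) \<le> d * (9 / 4 * n)" by (simp add: mult_ac)
    then have b: "K * b \<le> 9 / 4 * n" using d8 by simp
    have q: "K * q \<le> 3 / 2 * n" using card_large_le by (simp add: K_def q_def n_def)
    have "card small \<le> l * (card B + card large)"
      using few card_hubs_le by (meson le_trans mult_le_mono2)
    then have "real (card small) \<le> real (l * (card B + card large))" by (simp only: of_nat_le_iff)
    then have "s \<le> L * (b + q)" by (simp add: s_def L_def b_def q_def)
    then have "K * s \<le> K * (L * (b + q))" using K by (intro mult_left_mono) auto
    also have "\<dots> = L * (K * b + K * q)" by (simp add: algebra_simps)
    also have "\<dots> \<le> L * (15 / 4 * n)" using b q L by (intro mult_left_mono) auto
    finally have s: "K * s \<le> 15 / 4 * (L * n)" by simp
    have "2 * n \<le> L * n" using L n by (intro mult_right_mono) auto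
    moreover have "K * N \<le> K * b + K * s + 3 * n"
      using card_partition_le by (simp add: K_def N_def b_def s_def n_def algebra_simps)
    \<comment> \<open>With n at most Ln/2, the contributions 9n/4, 15Ln/4 and 3n sum to at most
      51Ln/8.\<close>
    ultimately have KN: "K * N \<le> 8 * (L * n)" using b s n by linarith
    have pos: "0 \<le> (1 - 2 * K * \<epsilon>) * d" using Ke d8 \<epsilon> K by (intro mult_nonneg_nonneg) auto
    have "K / (8 * L) * (1 - 2 * K * \<epsilon>) * d * N = (K * N / (8 * L)) * ((1 - 2 * K * \<epsilon>) * d)"
      by (simp add: mult_ac)
    also have "\<dots> \<le> n * ((1 - 2 * K * \<epsilon>) * d)"
      using KN L pos by (intro mult_right_mono) (auto simp: field_simps)
    also have "\<dots> = d * n - c * n * (2 * K)" by (simp add: c_def algebra_simps)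
    \<comment> \<open>The initial penalty per vertex is at most 2kc, the source of the factor
      \<open>1 - 2 * k * \<epsilon>\<close>.\<close>
    also have "\<dots> \<le> d * n - c * n * (K + 1 + 2 / K)"
    proof -
      have "2 / K \<le> 1" using K by simp
      then have "K + 1 + 2 / K \<le> 2 * K" using K by linarith
      then show ?thesis using c1 n by (intro diff_left_mono mult_left_mono) auto
    qed
    also have "\<dots> \<le> real (card (adj_pairs E P)) / 2" using adj dens(1) by (simp add: n_def K_def)
    finally show ?thesis using P unfolding K_def L_def N_def by blast
  qed
qed

section \<open>Assembling the result for arbitrary graphs\<close>

theorem theorem4p4:
  fixes k l :: nat and \<epsilon> d :: real and G :: "'a graph"
  assumes "2 \<le> l" and "l \<le> k"
    and "0 < \<epsilon>" and "\<epsilon> < 1 / (4 * real k)"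
    and "simple_graph G"
    and "d = density G" and "d \<ge> 1 / \<epsilon>"
  shows "(\<exists>H. subgraph H G \<and> real (card (verts H)) \<le> 3 * real k ^ 3 * d
            \<and> real (card (edges H)) \<ge> \<epsilon>\<^sup>2 * d\<^sup>2 / 2)
       \<or> (\<exists>H X Y. subgraph H G \<and> bipartition H X Y \<and> card X > l * card Y
            \<and> (\<forall>x\<in>X. real (card (neighbors H x \<inter> Y)) \<ge> (1 - 2 * real k * \<epsilon>) * d))
       \<or> (\<exists>G' :: 'a graph. bounded_minor k G' G
            \<and> density G' \<ge> real k / (8 * real l) * (1 - 2 * real k * \<epsilon>) * d)"
proof -
  have V: "finite (verts G)" and E: "\<forall>e\<in>edges G. e \<subseteq> verts G \<and> card e = 2"
    using assms(5) by (auto simp: simple_graph_def)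
  have kl: "2 \<le> real l" "real l \<le> real k" using assms(1,2) by auto
  have "0 < 1 / \<epsilon>" using assms(3) by simp
  then have d: "0 < d" using assms(7) by linarith
  then have Vne: "verts G \<noteq> {}" using assms(6) by (auto simp: density_def)
  then have V0: "0 < real (card (verts G))" using V by (simp add: card_gt_0_iff)
  have dE: "d * real (card (verts G)) = real (card (edges G))"
    using V0 assms(6) by (simp add: density_def)
  have "4 * real k * \<epsilon> < 1" using assms(4) kl by (simp add: field_simps)
  then have e1: "0 \<le> 1 - 2 * real k * \<epsilon>" using assms(3) kl by simp
  have minor: "\<exists>M :: 'a graph. bounded_minor k M G \<and> x \<le> density M"
    if bp: "branch_partition V' E' B k P" and V': "V' \<subseteq> verts G" "V' \<noteq> {}" and E': "E' \<subseteq> edges G"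
      and x: "x * real (card P) \<le> real (card (adj_pairs E' P)) / 2" for V' E' B P x
  proof -
    have fin: "finite V'" using V V'(1) finite_subset by blast
    obtain M :: "'a graph" where M: "bounded_minor k M G" "card (verts M) = card P"
      "2 * card (edges M) = card (adj_pairs E' P)"
      using bounded_minor_of_branch_partition[OF bp fin V'(1) E'] .
    have "P \<noteq> {}" using bp V'(2) by (auto simp: branch_partition_def)
    then have "0 < card P" using branch_partition_finite[OF bp fin] by (simp add: card_gt_0_iff)
    moreover have "x * real (card P) \<le> real (card (edges M))" using x M(3) by linarith
    ultimately have "x \<le> density M" by (simp add: density_def M(2) field_simps)
    then show ?thesis using M by blast
  qed
  show ?thesis
  proof (cases "k \<le> 8 * l")
    case True
    \<comment> \<open>Singleton branch sets represent \<open>G\<close> itself, whose density d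
      suffices because k/(8l) is at most 1.\<close>
    let ?P = "(\<lambda>v. {v}) ` verts G"
    have "branch_partition (verts G) (edges G) {} k ?P"
      using assms(1,2) by (intro branch_partition_singletons) auto
    moreover have "real k / (8 * real l) * (1 - 2 * real k * \<epsilon>) * d * real (card ?P)
        \<le> real (card (adj_pairs (edges G) ?P)) / 2"
    proof -
      have "real k / (8 * real l) \<le> 1" using True kl by (simp add: field_simps)
      then have "real k / (8 * real l) * (1 - 2 * real k * \<epsilon>) \<le> 1 * 1"
        using e1 assms(3) kl by (intro mult_mono) auto
      then have "real k / (8 * real l) * (1 - 2 * real k * \<epsilon>) * (d * real (card (verts G)))
          \<le> 1 * 1 * (d * real (card (verts G)))"
        using d by (intro mult_right_mono) auto
      moreover have "card ?P = card (verts G)" by (simp add: card_image)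
      ultimately show ?thesis
        using dE card_adj_pairs_singletons[OF V E] by (simp add: mult.assoc)
    qed
    ultimately show ?thesis using minor Vne by blast
  next
    case False
    obtain V' E' where VE: "V' \<subseteq> verts G" "E' \<subseteq> edges G" "V' \<noteq> {}" "\<forall>e\<in>E'. e \<subseteq> V'"
      "d * real (card V') \<le> real (card E')" "real (card E') \<le> d * real (card V') + 1"
      "\<forall>v\<in>V'. d \<le> real (card {u. {v, u} \<in> E'})"
      using dense_subgraph_min_degree[OF V Vne E d] dE by auto
    have fin: "finite V'" using V VE(1) finite_subset by blast
    have E': "\<forall>e\<in>E'. e \<subseteq> V' \<and> card e = 2" using VE E by blast
    \<comment> \<open>Here k > 8l and l is at least 2, so k exceeds 16.\<close>
    have k: "12 \<le> k" using False assms(1) by simp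
    from min_degree_trichotomy[OF fin VE(3) E' assms(1) k assms(3,4,7) VE(7,5,6)]
    consider (dense) W where "W \<subseteq> V'" "real (card W) \<le> 3 * real k ^ 3 * d"
        "real (card {e \<in> E'. e \<subseteq> W}) \<ge> \<epsilon>\<^sup>2 * d\<^sup>2 / 2"
      | (bip) X Y where "X \<subseteq> V'" "Y \<subseteq> V'" "X \<inter> Y = {}" "card X > l * card Y"
        "\<forall>x\<in>X. real (card ({u. {x, u} \<in> E'} \<inter> Y)) \<ge> (1 - 2 * real k * \<epsilon>) * d"
      | (min) B P where "branch_partition V' E' B k P"
        "real k / (8 * real l) * (1 - 2 * real k * \<epsilon>) * d * real (card P)
          \<le> real (card (adj_pairs E' P)) / 2"
      by blast
    then show ?thesis
    proof cases
      case dense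
      let ?H = "Graph W {e \<in> E'. e \<subseteq> W}"
      have "subgraph ?H G"
        using dense(1) fin VE E' finite_subset[OF dense(1) fin]
        by (auto simp: subgraph_def simple_graph_def)
      then show ?thesis using dense(2,3) by (intro disjI1 exI[of _ ?H]) simp
    next
      case bip
      \<comment> \<open>Discarding the edges inside \<open>X\<close> or inside \<open>Y\<close>
        makes the graph bipartite without changing which neighbours in \<open>Y\<close> a vertex of
        \<open>X\<close> has.\<close>
      let ?H = "Graph (X \<union> Y) {e \<in> E'. \<exists>x\<in>X. \<exists>y\<in>Y. e = {x, y}}"
      have "finite (X \<union> Y)" using bip(1,2) fin finite_subset by blast
      then have "subgraph ?H G"
        using bip(1,2) VE E' by (auto simp: subgraph_def simple_graph_def)
      moreover have "bipartition ?H X Y" using bip(3) by (auto simp: bipartition_def)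
      moreover have "neighbors ?H x \<inter> Y = {u. {x, u} \<in> E'} \<inter> Y" if "x \<in> X" for x
        using that by (auto simp: neighbors_def)
      ultimately show ?thesis using bip(4,5)
        by (intro disjI2 disjI1 exI[of _ ?H] exI[of _ X] exI[of _ Y]) simp
    next
      case min
      then show ?thesis using minor[OF min(1) VE(1,3,2) min(2)] by blast
    qed
  qed
qed

end
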